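(* Let $(p_1,p_2,p_3,p_4)$ be a balanced ideal tetrahedron with pairwise distinct vertices, and let $\lambda_A$ and $\lambda_B$ be two complex numbers of modulus $1$. There exists a unique representation $\rho:F_2=\langle a,b\rangle\to\mathrm{PU}(2,1)$ such that - $A=\rho(a)$ fixes $p_1$ with eigenvalue $\lambda_A$, and $B=\rho(b)$ fixes $p_2$ with eigenvalue $\lambda_B$; - $AB=\rho(ab)$ and $BA=\rho(ba)$ are parabolic or boundary elliptic and fix respectively $p_3$ and $p_4$.
   Context: $F_2=\langle a,b\rangle$ is the free group of rank two. $\langle\cdot,\cdot\rangle$ is a Hermitian form of signature $(2,1)$ on $\mathbb{C}^3$; $\mathbf{H}^2_{\mathbb{C}}$ (resp. $\partial\mathbf{H}^2_{\mathbb{C}}$) is the set of complex lines in $\mathbb{C}^3$ spanned by negative (resp. non-zero null) vectors, and $\mathrm{PU}(2,1)$ is the holomorphic isometry group of $\mathbf{H}^2_{\mathbb{C}}$. A lift of a point is a non-zero vector spanning the corresponding line. An isometry fixes a boundary point $p$ with eigenvalue $\lambda$ if it has a lift $T\in\mathrm{SU}(2,1)$ with $T\mathbf{p}=\lambda\mathbf{p}$, where $\mathbf{p}$ is a lift of $p$. A parabolic isometry is one with exactly one fixed point in $\mathbf{H}^2_{\mathbb{C}}\cup\partial\mathbf{H}^2_{\mathbb{C}}$, lying on $\partial\mathbf{H}^2_{\mathbb{C}}$. An isometry is boundary elliptic if it is elliptic (fixes a point of $\mathbf{H}^2_{\mathbb{C}}$) and also fixes a point of $\partial\mathbf{H}^2_{\mathbb{C}}$.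 An ideal tetrahedron is an ordered $4$-tuple $(p_1,p_2,p_3,p_4)$ of points of $\partial\mathbf{H}^2_{\mathbb{C}}$. It is balanced if $p_3$ and $p_4$ have the same image under the orthogonal projection $\pi_{12}$ onto the real geodesic $\gamma_{12}$ with endpoints $p_1,p_2$. Explicitly, choosing lifts with $\langle\mathbf{p}_1,\mathbf{p}_2\rangle=-1$, the projection of a point $z\neq p_1,p_2$ of $\mathbf{H}^2_{\mathbb{C}}\cup\partial\mathbf{H}^2_{\mathbb{C}}$ (with lift $\mathbf{z}$) is the point represented by $$\sqrt{\frac{|\langle\mathbf{z},\mathbf{p}_2\rangle|}{|\langle\mathbf{z},\mathbf{p}_1\rangle|}}\,\mathbf{p}_1+\sqrt{\frac{|\langle\mathbf{z},\mathbf{p}_1\rangle|}{|\langle\mathbf{z},\mathbf{p}_2\rangle|}}\,\mathbf{p}_2 .$$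
   Formalization: Uniqueness is false as stated (for eigenvalues 1 the trivial representation also qualifies); the formal version additionally requires that B maps p_3 to p_4 whenever AB is boundary elliptic, so uniqueness is among representations meeting this extra condition. *)

theory Defs
  imports "HOL-Analysis.Analysis" "HOL-Algebra.Coset"
begin

section \<open>The free group of rank two\<close>

datatype generator = Gen_a | Gen_b

text \<open>A letter is a generator together with a flag that is \<open>True\<close> for its formal inverse.\<close>

type_synonym letter = "generator \<times> bool"

definition cancels :: "letter \<Rightarrow> letter \<Rightarrow> bool" where
  "cancels x y \<longleftrightarrow> fst x = fst y \<and> snd x \<noteq> snd y"

definition reduced :: "letter list \<Rightarrow> bool" where
  "reduced w \<longleftrightarrow> successively (\<lambda>x y. \<not> cancels x y) w"

fun push :: "letter \<Rightarrow> letter list \<Rightarrow> letter list" where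
  "push x [] = [x]"
| "push x (y # ys) = (if cancels x y then ys else x # y # ys)"

definition F2 :: "letter list monoid" where
  "F2 = \<lparr>carrier = {w. reduced w}, monoid.mult = (\<lambda>u v. foldr push u v), one = []\<rparr>"

definition gen_a :: "letter list" where "gen_a = [(Gen_a, False)]"
definition gen_b :: "letter list" where "gen_b = [(Gen_b, False)]"

lemma reduced_push: "reduced w \<Longrightarrow> reduced (push x w)"
  by (cases w) (auto simp: reduced_def successively_Cons)

lemma reduced_foldr_push: "reduced w \<Longrightarrow> reduced (foldr push u w)"
  by (induction u) (auto simp: reduced_push)

lemma push_push: "reduced w \<Longrightarrow> cancels x y \<Longrightarrow> push x (push y w) = w"
proof (cases w)
  case (Cons z zs)
  assume r: "reduced w" and c: "cancels x y"
  show ?thesis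
  proof (cases "cancels y z")
    case True
    then have xz: "x = z" using c by (cases x; cases z) (auto simp: cancels_def)
    show ?thesis using r True Cons xz by (cases zs) (auto simp: reduced_def)
  next
    case False
    then show ?thesis using c Cons by simp
  qed
qed simp

lemma foldr_push_push:
  assumes "reduced v" "reduced w"
  shows "foldr push (push x v) w = push x (foldr push v w)"
proof (cases v)
  case (Cons y ys)
  then show ?thesis using assms push_push[OF reduced_foldr_push[OF assms(2)], of x y ys]
    by auto
qed simp

lemma foldr_push_assoc:
  assumes "reduced v" "reduced w"
  shows "foldr push (foldr push u v) w = foldr push u (foldr push v w)"
  using assms by (induction u) (auto simp: foldr_push_push reduced_foldr_push)

lemma foldr_push_Nil: "reduced w \<Longrightarrow> foldr push w [] = w"
proof (induction w)
  case (Cons x w)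
  then show ?case by (cases w) (auto simp: reduced_def)
qed simp

lemma group_F2: "group F2"
proof (rule groupI)
  fix w assume "w \<in> carrier F2"
  then have "reduced w" by (simp add: F2_def)
  then have "\<exists>u. reduced u \<and> foldr push u w = []"
  proof (induction w)
    case (Cons x w)
    let ?x = "(fst x, \<not> snd x)"
    have c: "cancels ?x x" by (simp add: cancels_def)
    have rw: "reduced w" using Cons.prems by (cases w) (auto simp: reduced_def)
    then obtain u where u: "reduced u" "foldr push u w = []" using Cons.IH by blast
    have r1: "reduced [?x]" by (simp add: reduced_def)
    have "foldr push (foldr push u [?x]) (x # w) = foldr push u (foldr push [?x] (x # w))"
      by (rule foldr_push_assoc[OF r1 Cons.prems])
    also have "\<dots> = []" using u c by simp
    finally show ?case using reduced_foldr_push[OF r1] by blast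
  qed (auto simp: reduced_def intro: exI[of _ "[]"])
  then show "\<exists>u\<in>carrier F2. u \<otimes>\<^bsub>F2\<^esub> w = \<one>\<^bsub>F2\<^esub>" by (auto simp: F2_def)
qed (auto simp: F2_def reduced_foldr_push foldr_push_assoc, simp add: reduced_def)

section \<open>Hermitian forms of signature (2,1) and the complex hyperbolic plane\<close>

type_synonym form = "complex^3 \<Rightarrow> complex^3 \<Rightarrow> complex"

text \<open>Linear in the first argument, antilinear in the second.\<close>

definition hermitian_form :: "form \<Rightarrow> bool" where
  "hermitian_form h \<longleftrightarrow>
     (\<forall>u v w. h (u + v) w = h u w + h v w) \<and>
     (\<forall>c v w. h (c *s v) w = c * h v w) \<and>
     (\<forall>v w. h w v = cnj (h v w))"

definition signature_2_1 :: "form \<Rightarrow> bool" where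
  "signature_2_1 h \<longleftrightarrow> hermitian_form h \<and>
     (\<exists>e\<^sub>1 e\<^sub>2 e\<^sub>3. vec.span {e\<^sub>1, e\<^sub>2, e\<^sub>3} = UNIV \<and>
        h e\<^sub>1 e\<^sub>1 = 1 \<and> h e\<^sub>2 e\<^sub>2 = 1 \<and> h e\<^sub>3 e\<^sub>3 = -1 \<and>
        h e\<^sub>1 e\<^sub>2 = 0 \<and> h e\<^sub>1 e\<^sub>3 = 0 \<and> h e\<^sub>2 e\<^sub>3 = 0)"

text \<open>Points of the complex projective plane are complex lines, as subsets of \<open>complex^3\<close>.\<close>

type_synonym point = "(complex^3) set"

definition is_lift :: "complex^3 \<Rightarrow> point \<Rightarrow> bool" where
  "is_lift v p \<longleftrightarrow> v \<noteq> 0 \<and> p = vec.span {v}"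

text \<open>\<open>h v v\<close> is real for a Hermitian form.\<close>

definition H2C :: "form \<Rightarrow> point set" where
  "H2C h = {p. \<exists>v. is_lift v p \<and> Re (h v v) < 0}"

definition bdH2C :: "form \<Rightarrow> point set" where
  "bdH2C h = {p. \<exists>v. is_lift v p \<and> h v v = 0}"

section \<open>The group PU(2,1)\<close>

definition U21 :: "form \<Rightarrow> (complex^3^3) monoid" where
  "U21 h = \<lparr>carrier = {T. \<forall>v w. h (T *v v) (T *v w) = h v w},
            monoid.mult = (**), one = mat 1\<rparr>"

definition unit_scalars :: "(complex^3^3) set" where
  "unit_scalars = {mat c | c. cmod c = 1}"

text \<open>An element of \<open>PU21 h\<close> is a coset, that is, the set of all its lifts to \<open>U21 h\<close>.\<close>

definition PU21 :: "form \<Rightarrow> (complex^3^3) set monoid" where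
  "PU21 h = U21 h Mod unit_scalars"

text \<open>
  All lifts of an isometry map a complex line to the same line, so the union below is that line.
\<close>

definition act :: "(complex^3^3) set \<Rightarrow> point \<Rightarrow> point" where
  "act A p = (\<Union>T\<in>A. (*v) T ` p)"

definition fixes_with_eigenvalue :: "(complex^3^3) set \<Rightarrow> point \<Rightarrow> complex \<Rightarrow> bool" where
  "fixes_with_eigenvalue A p l \<longleftrightarrow> (\<exists>T\<in>A. det T = 1 \<and> (\<exists>v. is_lift v p \<and> T *v v = l *s v))"

definition parabolic :: "form \<Rightarrow> (complex^3^3) set \<Rightarrow> bool" where
  "parabolic h A \<longleftrightarrow> (\<exists>p\<in>bdH2C h. {x \<in> H2C h \<union> bdH2C h. act A x = x} = {p})"

definition elliptic :: "form \<Rightarrow> (complex^3^3) set \<Rightarrow> bool" where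
  "elliptic h A \<longleftrightarrow> (\<exists>x\<in>H2C h. act A x = x)"

text \<open>
  The identity is boundary elliptic. A boundary elliptic isometry fixes infinitely many boundary
  points. So if \<open>AB\<close> and \<open>BA\<close> are boundary elliptic and fix \<open>p\<^sub>3\<close> and \<open>p\<^sub>4\<close>, these need not
  correspond under the conjugation of \<open>AB\<close> into \<open>BA\<close> by \<open>B\<close>, as they must when \<open>AB\<close> is parabolic,
  and then \<open>A\<close> and \<open>B\<close> need not be unique (for both eigenvalues equal to 1 one can take
  \<open>A = B = 1\<close>, whatever the four points). The theorem therefore asks for \<open>B p\<^sub>3 = p\<^sub>4\<close> explicitly
  in that case.
\<close>

definition boundary_elliptic :: "form \<Rightarrow> (complex^3^3) set \<Rightarrow> bool" where
  "boundary_elliptic h A \<longleftrightarrow> elliptic h A \<and> (\<exists>p\<in>bdH2C h. act A p = p)"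

section \<open>Balanced ideal tetrahedra\<close>

definition proj_vector :: "form \<Rightarrow> complex^3 \<Rightarrow> complex^3 \<Rightarrow> complex^3 \<Rightarrow> complex^3" where
  "proj_vector h v\<^sub>1 v\<^sub>2 z =
     complex_of_real (sqrt (cmod (h z v\<^sub>2) / cmod (h z v\<^sub>1))) *s v\<^sub>1 +
     complex_of_real (sqrt (cmod (h z v\<^sub>1) / cmod (h z v\<^sub>2))) *s v\<^sub>2"

text \<open>
  Orthogonal projection onto the geodesic with endpoints \<open>p\<^sub>1\<close>, \<open>p\<^sub>2\<close>; it does not depend on the
  lifts by \<open>geodesic_proj_eq\<close> below. It is meaningful for \<open>p\<^sub>1 \<noteq> p\<^sub>2\<close> and \<open>z \<notin> {p\<^sub>1, p\<^sub>2}\<close>.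
\<close>

definition geodesic_proj :: "form \<Rightarrow> point \<Rightarrow> point \<Rightarrow> point \<Rightarrow> point" where
  "geodesic_proj h p\<^sub>1 p\<^sub>2 z =
     (THE x. \<exists>v\<^sub>1 v\<^sub>2 w. is_lift v\<^sub>1 p\<^sub>1 \<and> is_lift v\<^sub>2 p\<^sub>2 \<and> is_lift w z \<and> h v\<^sub>1 v\<^sub>2 = -1 \<and>
        x = vec.span {proj_vector h v\<^sub>1 v\<^sub>2 w})"

definition balanced :: "form \<Rightarrow> point \<Rightarrow> point \<Rightarrow> point \<Rightarrow> point \<Rightarrow> bool" where
  "balanced h p\<^sub>1 p\<^sub>2 p\<^sub>3 p\<^sub>4 \<longleftrightarrow> {p\<^sub>1, p\<^sub>2, p\<^sub>3, p\<^sub>4} \<subseteq> bdH2C h \<and>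
     geodesic_proj h p\<^sub>1 p\<^sub>2 p\<^sub>3 = geodesic_proj h p\<^sub>1 p\<^sub>2 p\<^sub>4"

lemma is_lift_scale:
  assumes "is_lift v p" "is_lift w p"
  obtains c where "c \<noteq> 0" "w = c *s v"
proof -
  have "w \<in> vec.span {v}" using assms vec.span_base[of w "{w}"] by (auto simp: is_lift_def)
  then obtain c where "w = c *s v" by (auto simp: vec.span_singleton)
  then show ?thesis using assms that by (auto simp: is_lift_def)
qed

lemma span_scale: "c \<noteq> 0 \<Longrightarrow> vec.span {c *s v} = vec.span {v :: complex^3}"
proof -
  assume c: "c \<noteq> 0"
  have "v = inverse c *s (c *s v)" using c by (simp add: vector_smult_assoc)
  then have "v \<in> vec.span {c *s v}" by (metis vec.span_base vec.span_scale singletonI)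
  moreover have "c *s v \<in> vec.span {v}" by (simp add: vec.span_base vec.span_scale)
  ultimately show ?thesis unfolding vec.span_eq by simp
qed

lemma proj_vector_scale:
  assumes h: "hermitian_form h" and n: "h v\<^sub>1 v\<^sub>2 = -1" "h (a *s v\<^sub>1) (b *s v\<^sub>2) = -1" and c: "c \<noteq> 0"
  shows "\<exists>d. d \<noteq> 0 \<and> proj_vector h (a *s v\<^sub>1) (b *s v\<^sub>2) (c *s w) = d *s proj_vector h v\<^sub>1 v\<^sub>2 w"
proof -
  have l1: "h (x *s u) v = x * h u v" and sym: "h v u = cnj (h u v)" for x u v
    using h unfolding hermitian_form_def by blast+
  have l: "h (x *s u) (y *s v) = x * cnj y * h u v" for x y u v
  proof -
    have "h u (y *s v) = cnj y * h u v"
      by (metis sym l1 complex_cnj_mult)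
    then show ?thesis by (simp add: l1)
  qed
  have ab: "a * cnj b = 1" using n l[of a v\<^sub>1 b v\<^sub>2] by simp
  then have a0: "a \<noteq> 0" and b0: "b \<noteq> 0" by auto
  have mab: "cmod a * cmod b = 1" using ab by (metis complex_mod_cnj norm_mult norm_one)
  have sc: "cmod (h (c *s w) (y *s v)) = cmod c * cmod y * cmod (h w v)" for y v
    by (simp add: l norm_mult)
  have b: "cmod b = 1 / cmod a" using mab a0 by (simp add: field_simps)
  have r1: "sqrt (cmod (h (c *s w) (b *s v\<^sub>2)) / cmod (h (c *s w) (a *s v\<^sub>1)))
      = sqrt (cmod (h w v\<^sub>2) / cmod (h w v\<^sub>1)) / cmod a"
    using c a0 by (simp add: sc b real_sqrt_divide real_sqrt_mult)
  have r2: "sqrt (cmod (h (c *s w) (a *s v\<^sub>1)) / cmod (h (c *s w) (b *s v\<^sub>2)))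
      = sqrt (cmod (h w v\<^sub>1) / cmod (h w v\<^sub>2)) * cmod a"
    using c a0 by (simp add: sc b real_sqrt_divide real_sqrt_mult)
  have "cnj a * b = 1" using ab by (metis complex_cnj_cnj complex_cnj_mult complex_cnj_one)
  then have "complex_of_real (cmod a) * b * (complex_of_real (cmod a) * cnj a) =
     complex_of_real (cmod a)^2" by (simp add: power2_eq_square algebra_simps)
  then have "complex_of_real (cmod a) * b * (complex_of_real (cmod a) * cnj a) = a * cnj a"
    by (simp only: complex_norm_square of_real_power[symmetric])
  then have e: "complex_of_real (cmod a) * b = a / complex_of_real (cmod a)"
    using a0 by (simp add: field_simps)
  have e1: "complex_of_real (x / cmod a) * a = a / complex_of_real (cmod a) * complex_of_real x" for x
    by simp
  have e2: "complex_of_real (x * cmod a) * b = a / complex_of_real (cmod a) * complex_of_real x" for x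
    unfolding e[symmetric] by simp
  have "proj_vector h (a *s v\<^sub>1) (b *s v\<^sub>2) (c *s w)
     = (a / complex_of_real (cmod a)) *s proj_vector h v\<^sub>1 v\<^sub>2 w"
    unfolding proj_vector_def r1 r2 vector_add_ldistrib vector_smult_assoc e1 e2 ..
  then show ?thesis using a0 by (intro exI[of _ "a / complex_of_real (cmod a)"]) simp
qed

lemma geodesic_proj_eq:
  assumes h: "hermitian_form h"
    and l: "is_lift v\<^sub>1 p\<^sub>1" "is_lift v\<^sub>2 p\<^sub>2" "is_lift w z" "h v\<^sub>1 v\<^sub>2 = -1"
  shows "geodesic_proj h p\<^sub>1 p\<^sub>2 z = vec.span {proj_vector h v\<^sub>1 v\<^sub>2 w}"
  unfolding geodesic_proj_def
proof (rule the_equality)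
  fix x assume "\<exists>v\<^sub>1 v\<^sub>2 w. is_lift v\<^sub>1 p\<^sub>1 \<and> is_lift v\<^sub>2 p\<^sub>2 \<and> is_lift w z \<and> h v\<^sub>1 v\<^sub>2 = -1 \<and>
        x = vec.span {proj_vector h v\<^sub>1 v\<^sub>2 w}"
  then obtain u\<^sub>1 u\<^sub>2 u where u: "is_lift u\<^sub>1 p\<^sub>1" "is_lift u\<^sub>2 p\<^sub>2" "is_lift u z" "h u\<^sub>1 u\<^sub>2 = -1"
    "x = vec.span {proj_vector h u\<^sub>1 u\<^sub>2 u}" by blast
  obtain a where a: "u\<^sub>1 = a *s v\<^sub>1" using is_lift_scale[OF l(1) u(1)] by metis
  obtain b where b: "u\<^sub>2 = b *s v\<^sub>2" using is_lift_scale[OF l(2) u(2)] by metis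
  obtain c where c: "c \<noteq> 0" "u = c *s w" using is_lift_scale[OF l(3) u(3)] by metis
  show "x = vec.span {proj_vector h v\<^sub>1 v\<^sub>2 w}"
  proof -
    have n: "h (a *s v\<^sub>1) (b *s v\<^sub>2) = -1" using u(4) a b by simp
    obtain d where "d \<noteq> 0"
      "proj_vector h (a *s v\<^sub>1) (b *s v\<^sub>2) (c *s w) = d *s proj_vector h v\<^sub>1 v\<^sub>2 w"
      using proj_vector_scale[OF h l(4) n c(1)] by blast
    then show ?thesis using u(5) a b c(2) span_scale by simp
  qed
qed (use l in blast)

end

theory Submission
  imports Defs
begin

text \<open>
  Write \<open>A\<close> and \<open>B\<close> for the images of the two generators. Since \<open>F2\<close> is free, a representation
  is the same as the pair \<open>(A, B)\<close> (\<open>F2_universal\<close>), and the conditions in the theorem are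
  conditions on this pair. The point of the proof is that, once the eigenvalues at \<open>p\<^sub>1\<close> and \<open>p\<^sub>2\<close>
  are prescribed, they say exactly that \<open>A p\<^sub>4 = p\<^sub>3\<close> and \<open>B p\<^sub>3 = p\<^sub>4\<close>
  (\<open>vertex_conditions_iff_swap\<close>).

  If the conditions hold and \<open>AB\<close> is parabolic, then \<open>p\<^sub>3\<close> is its only fixed point on the boundary,
  but \<open>A p\<^sub>4\<close> is fixed by \<open>AB = A (BA) A\<inverse>\<close> as well; so \<open>A p\<^sub>4 = p\<^sub>3\<close>, and
  \<open>B p\<^sub>3 = BA p\<^sub>4 = p\<^sub>4\<close>. If \<open>AB\<close> is boundary elliptic, then \<open>B p\<^sub>3 = p\<^sub>4\<close> is assumed, and
  \<open>A p\<^sub>4 = AB p\<^sub>3 = p\<^sub>3\<close>. Conversely, if \<open>A\<close> and \<open>B\<close> exchange \<open>p\<^sub>3\<close> and \<open>p\<^sub>4\<close> in this way, then \<open>AB\<close>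
  fixes \<open>p\<^sub>3\<close> and \<open>BA\<close> fixes \<open>p\<^sub>4\<close>, with the same eigenvalue. Its modulus is the quotient of
  \<open>\<bar>\<langle>p\<^sub>3, p\<^sub>2\<rangle>\<bar> \<bar>\<langle>p\<^sub>4, p\<^sub>1\<rangle>\<bar>\<close> by \<open>\<bar>\<langle>p\<^sub>4, p\<^sub>2\<rangle>\<bar> \<bar>\<langle>p\<^sub>3, p\<^sub>1\<rangle>\<bar>\<close>, which is \<open>1\<close> because the tetrahedron
  is balanced (\<open>balanced_cross_ratio\<close>, \<open>product_eigenvalue_unitary\<close>). An isometry with an
  eigenvalue of modulus \<open>1\<close> at a boundary point is not loxodromic, hence parabolic or boundary
  elliptic (\<open>unitary_eigenvalue_imp_parabolic_or_elliptic\<close>).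

  It remains to see that there is exactly one isometry fixing \<open>p\<close> with a given unitary eigenvalue
  and sending \<open>q\<close> to \<open>q'\<close>, where \<open>p\<close> differs from \<open>q\<close> and \<open>q'\<close> (\<open>isometry_with_eigenvalue\<close>);
  geometrically, the Heisenberg group acts simply transitively on the boundary minus \<open>p\<close>. Here it
  comes from a Witt-type statement: an isometry of determinant \<open>1\<close> is determined by the images of
  two non-orthogonal null vectors, and these images can be any two null vectors with the same
  product. The third basis vector is a unit normal to the pair. That a positive normal exists, and
  that distinct null lines are never orthogonal, is read off from Gram determinants, which are
  negative for every basis because the signature is \<open>(2, 1)\<close>.
\<close>

section \<open>The universal property of the free group\<close>

definition letter_value :: "('g, 'm) monoid_scheme \<Rightarrow> 'g \<Rightarrow> 'g \<Rightarrow> letter \<Rightarrow> 'g" where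
  "letter_value G x y l =
     (let g = (case fst l of Gen_a \<Rightarrow> x | Gen_b \<Rightarrow> y) in if snd l then inv\<^bsub>G\<^esub> g else g)"

definition word_value :: "('g, 'm) monoid_scheme \<Rightarrow> 'g \<Rightarrow> 'g \<Rightarrow> letter list \<Rightarrow> 'g" where
  "word_value G x y w = foldr (\<lambda>l g. letter_value G x y l \<otimes>\<^bsub>G\<^esub> g) w \<one>\<^bsub>G\<^esub>"

context group
begin

lemma letter_value_closed:
  "x \<in> carrier G \<Longrightarrow> y \<in> carrier G \<Longrightarrow> letter_value G x y l \<in> carrier G"
  by (auto simp: letter_value_def Let_def split: generator.split)

lemma letter_value_cancels:
  "x \<in> carrier G \<Longrightarrow> y \<in> carrier G \<Longrightarrow> cancels l m \<Longrightarrow>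
    letter_value G x y l \<otimes> letter_value G x y m = \<one>"
  by (auto simp: letter_value_def Let_def cancels_def split: generator.split)

lemma word_value_Cons: "word_value G x y (l # w) = letter_value G x y l \<otimes> word_value G x y w"
  by (simp add: word_value_def)

lemma word_value_closed:
  "x \<in> carrier G \<Longrightarrow> y \<in> carrier G \<Longrightarrow> word_value G x y w \<in> carrier G"
  by (induction w) (simp_all add: word_value_Cons letter_value_closed, simp add: word_value_def)

text \<open>
  The product in \<open>F2\<close> is computed by pushing the letters of the first word onto the second, so
  multiplicativity of the value of a word reduces to the case of a single letter, where either
  nothing cancels or two mutually inverse values do.
\<close>

lemma word_value_push:
  assumes "x \<in> carrier G" "y \<in> carrier G"
  shows "word_value G x y (push l w) = letter_value G x y l \<otimes> word_value G x y w"
proof (cases w)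
  case (Cons m v)
  then show ?thesis
    using assms by (auto simp: word_value_Cons word_value_closed letter_value_closed
        letter_value_cancels m_assoc[symmetric])
qed (simp add: word_value_Cons)

lemma word_value_foldr_push:
  assumes "x \<in> carrier G" "y \<in> carrier G"
  shows "word_value G x y (foldr push u w) = word_value G x y u \<otimes> word_value G x y w"
proof (induction u)
  case Nil
  show ?case using assms by (simp add: word_value_closed) (simp add: word_value_def word_value_closed assms)
next
  case (Cons l u)
  then show ?case
    using assms by (simp add: word_value_push word_value_Cons letter_value_closed word_value_closed m_assoc)
qed

lemma F2_hom_eqI:
  assumes f: "f \<in> hom F2 G" and g: "g \<in> hom F2 G"
    and a: "f gen_a = g gen_a" and b: "f gen_b = g gen_b"
    and w: "w \<in> carrier F2"
  shows "f w = g w"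
proof -
  interpret f: group_hom F2 G f using f group_F2 is_group by (simp add: group_hom_def group_hom_axioms_def)
  interpret g: group_hom F2 G g using g group_F2 is_group by (simp add: group_hom_def group_hom_axioms_def)
  have gens: "gen_a \<in> carrier F2" "gen_b \<in> carrier F2"
    by (simp_all add: F2_def gen_a_def gen_b_def reduced_def)
  have single: "[l] \<in> carrier F2" for l by (simp add: F2_def reduced_def)
  \<comment> \<open>A homomorphism is determined on inverse letters by its values on the generators.\<close>
  have inv: "[(c, True)] = inv\<^bsub>F2\<^esub> [(c, False)]" for c
    by (rule f.inv_equality[symmetric, OF _ single single]) (simp add: F2_def cancels_def)
  have letter: "f [l] = g [l]" for l
  proof -
    obtain c s where l: "l = (c, s)" by (cases l)
    have p: "f [(c, False)] = g [(c, False)]"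
      using a b by (cases c) (simp_all add: gen_a_def gen_b_def)
    show ?thesis
      using p by (cases s) (simp_all add: l inv single)
  qed
  have "reduced w" using w by (simp add: F2_def)
  then show ?thesis
  proof (induction w)
    case Nil
    have "[] = \<one>\<^bsub>F2\<^esub>" by (simp add: F2_def)
    then show ?case by (metis f.hom_one g.hom_one)
  next
    case (Cons l w)
    then have rw: "w \<in> carrier F2" by (cases w) (auto simp: reduced_def F2_def)
    have "l # w = [l] \<otimes>\<^bsub>F2\<^esub> w"
      using Cons.prems by (cases w) (auto simp: reduced_def F2_def)
    moreover have "f w = g w" using Cons rw by (simp add: F2_def)
    ultimately show ?case using letter rw single by simp
  qed
qed

lemma F2_universal:
  assumes "x \<in> carrier G" "y \<in> carrier G"
  shows "\<exists>!f. f \<in> hom F2 G \<and> f \<in> extensional (carrier F2) \<and> f gen_a = x \<and> f gen_b = y"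
proof -
  define g where "g = restrict (word_value G x y) (carrier F2)"
  have g_hom: "g \<in> hom F2 G"
  proof (rule homI)
    fix u assume "u \<in> carrier F2"
    then show "g u \<in> carrier G" using assms by (simp add: g_def word_value_closed)
  next
    fix u v assume "u \<in> carrier F2" "v \<in> carrier F2"
    then show "g (u \<otimes>\<^bsub>F2\<^esub> v) = g u \<otimes> g v"
      using assms by (simp add: g_def F2_def reduced_foldr_push word_value_foldr_push)
  qed
  have g_gens: "g gen_a = x" "g gen_b = y"
    using assms by (simp_all add: g_def F2_def gen_a_def gen_b_def reduced_def
        word_value_def letter_value_def)
  show ?thesis
  proof (rule ex1I[of _ g])
    show "g \<in> hom F2 G \<and> g \<in> extensional (carrier F2) \<and> g gen_a = x \<and> g gen_b = y"
      using g_hom g_gens by (simp add: g_def)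
  next
    fix f
    assume f: "f \<in> hom F2 G \<and> f \<in> extensional (carrier F2) \<and> f gen_a = x \<and> f gen_b = y"
    show "f = g"
    proof (rule extensionalityI)
      show "f \<in> extensional (carrier F2)" using f by blast
      show "g \<in> extensional (carrier F2)" by (simp add: g_def)
      show "f w = g w" if "w \<in> carrier F2" for w
        using F2_hom_eqI[OF _ g_hom _ _ that, of f] f g_gens by simp
    qed
  qed
qed

end

section \<open>Bases and Gram determinants\<close>

definition cols3 :: "complex^3 \<Rightarrow> complex^3 \<Rightarrow> complex^3 \<Rightarrow> complex^3^3" where
  "cols3 u v w = transpose (vector [u, v, w])"

lemma column_cols3:
  "column 1 (cols3 u v w) = u" "column 2 (cols3 u v w) = v" "column 3 (cols3 u v w) = w"
  by (simp_all add: cols3_def column_transpose row_def vector_3)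

lemma cols3_vector: "cols3 u v w *v x = x$1 *s u + x$2 *s v + x$3 *s w"
  unfolding matrix_mult_sum sum_3 column_cols3 ..

lemma matrix_mul_cols3: "T ** cols3 u v w = cols3 (T *v u) (T *v v) (T *v w)"
  by (simp add: vec_eq_iff forall_3 cols3_def matrix_matrix_mult_def matrix_vector_mult_def
      transpose_def vector_3)

lemma det_cols3:
  "det (cols3 u v w) = u$1 * v$2 * w$3 + v$1 * w$2 * u$3 + w$1 * u$2 * v$3
     - u$1 * w$2 * v$3 - v$1 * u$2 * w$3 - w$1 * v$2 * u$3"
  by (simp add: det_3 cols3_def transpose_def vector_3)

lemma det_cols3_scale: "det (cols3 u v (c *s w)) = c * det (cols3 u v w)"
  by (simp add: det_cols3 algebra_simps)

lemma det_cols3_add: "det (cols3 u v (w + a *s u + b *s v)) = det (cols3 u v w)"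
  by (simp add: det_cols3 algebra_simps)

text \<open>
  If no vector completes \<open>v\<close> and \<open>w\<close> to a basis, then in particular no standard basis vector does;
  these three determinants are the \<open>2 \<times> 2\<close> minors of \<open>(v, w)\<close>, and if they vanish, then \<open>w\<close> is
  a multiple of \<open>v\<close>.
\<close>

lemma extend_to_basis:
  assumes "v \<noteq> 0" "\<And>c. w \<noteq> c *s v"
  shows "\<exists>x. det (cols3 v w x) \<noteq> 0"
proof (rule ccontr)
  assume "\<nexists>x. det (cols3 v w x) \<noteq> 0"
  then have z: "det (cols3 v w x) = 0" for x by blast
  have m: "v$1 * w$2 = v$2 * w$1" "v$1 * w$3 = v$3 * w$1" "v$2 * w$3 = v$3 * w$2"
    using z[of "vector [0,0,1]"] z[of "vector [0,1,0]"] z[of "vector [1,0,0]"]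
    by (simp_all add: det_cols3 vector_3 algebra_simps)
  from assms(1) obtain k where k: "v$k \<noteq> 0" by (auto simp: vec_eq_iff)
  have minor: "w$j * v$k = w$k * v$j" for j
    using exhaust_3[of k] exhaust_3[of j] m by (elim disjE) (simp_all add: mult.commute)
  have "w = (w$k / v$k) *s v"
    using minor k by (simp add: vec_eq_iff nonzero_eq_divide_eq)
  then show False using assms(2) by blast
qed

definition gram :: "form \<Rightarrow> complex^3^3 \<Rightarrow> complex^3^3" where
  "gram h P = (\<chi> i j. h (column i P) (column j P))"

locale hermitian =
  fixes h :: form
  assumes herm: "hermitian_form h"
begin

lemma add_left: "h (u + v) w = h u w + h v w"
  and scale_left: "h (c *s v) w = c * h v w"
  and swap: "h w v = cnj (h v w)"
  using herm unfolding hermitian_form_def by blast+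

lemma add_right: "h u (v + w) = h u v + h u w"
  by (metis add_left swap complex_cnj_add)

lemma scale_right: "h v (c *s w) = cnj c * h v w"
  by (metis scale_left swap complex_cnj_mult)

lemma zero_left: "h 0 w = 0" using scale_left[of 0 0 w] by simp

lemma orthogonal_sym: "h v w = 0 \<Longrightarrow> h w v = 0"
  by (metis swap complex_cnj_zero)

lemmas form_simps = add_left scale_left add_right scale_right

lemma form_mult_vec:
  "h (P *v x) (P *v y) = (\<Sum>i\<in>UNIV. \<Sum>j\<in>UNIV. x$i * cnj (y$j) * gram h P $ i $ j)"
proof -
  have right: "h u (P *v y) = (\<Sum>j\<in>UNIV. cnj (y$j) * h u (column j P))" for u
    unfolding matrix_mult_sum sum_3 by (simp only: form_simps)
  have left: "h (P *v x) u = (\<Sum>i\<in>UNIV. x$i * h (column i P) u)" for u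
    unfolding matrix_mult_sum sum_3 by (simp only: form_simps)
  show ?thesis
    unfolding left right sum_distrib_left by (subst sum.swap) (simp add: gram_def mult_ac)
qed

lemma det_gram: "det (gram h P) = of_real ((cmod (det P))\<^sup>2) * det (gram h (mat 1))"
proof -
  define C where "C = (\<chi> i j. cnj (P$i$j))"
  have h: "h u v = (\<Sum>i\<in>UNIV. \<Sum>j\<in>UNIV. u$i * cnj (v$j) * gram h (mat 1) $ i $ j)" for u v
    using form_mult_vec[of "mat 1" u v] by simp
  have "gram h P = transpose P ** gram h (mat 1) ** C"
  proof -
    have "gram h P $ i $ j = (transpose P ** gram h (mat 1) ** C) $ i $ j" for i j
    proof -
      have "gram h P $ i $ j = (\<Sum>k\<in>UNIV. \<Sum>l\<in>UNIV. P$k$i * cnj (P$l$j) * gram h (mat 1) $ k $ l)"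
        using h[of "column i P" "column j P"] by (simp only: gram_def[of h P] column_def vec_lambda_beta)
      also have "\<dots> = (\<Sum>l\<in>UNIV. \<Sum>k\<in>UNIV. P$k$i * cnj (P$l$j) * gram h (mat 1) $ k $ l)"
        by (rule sum.swap)
      also have "\<dots> = (\<Sum>l\<in>UNIV. (\<Sum>k\<in>UNIV. P$k$i * gram h (mat 1) $ k $ l) * cnj (P$l$j))"
        unfolding sum_distrib_right by (simp only: mult_ac)
      finally show ?thesis by (simp add: C_def matrix_matrix_mult_def transpose_def)
    qed
    then show ?thesis by (simp only: vec_eq_iff) blast
  qed
  then have "det (gram h P) = det P * det (gram h (mat 1)) * det C"
    by (simp add: det_mul det_transpose)
  also have "det C = cnj (det P)" by (simp add: C_def det_3)
  finally show ?thesis unfolding complex_norm_square by (simp add: mult_ac)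
qed

text \<open>
  This expansion serves twice. If \<open>v\<close> and \<open>w\<close> are orthogonal, it vanishes. If \<open>x\<close> is orthogonal to
  both, only the last term survives, and it has the sign of \<open>- h x x\<close>.
\<close>

lemma det_gram_null_pair:
  assumes "h v v = 0" "h w w = 0"
  shows "det (gram h (cols3 v w x)) = 
     h v w * h w x * h x v + h v x * h w v * h x w - h v w * h w v * h x x"
  using assms by (simp add: det_3 gram_def column_cols3)

end

locale hyperbolic_form = hermitian +
  assumes sig: "signature_2_1 h"
begin

text \<open>
  The signature is used only through this sign: by \<open>det_gram\<close> the Gram determinant changes by a
  positive factor under a change of basis, and it is \<open>-1\<close> in an orthonormal basis.
\<close>

lemma det_gram_neg:
  obtains r :: real where "r > 0" "det (gram h (mat 1)) = - of_real r"
proof -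
  obtain e1 e2 e3 where e: "h e1 e1 = 1" "h e2 e2 = 1" "h e3 e3 = -1" "h e1 e2 = 0" "h e1 e3 = 0" "h e2 e3 = 0"
    using sig by (auto simp: signature_2_1_def)
  let ?d = "(cmod (det (cols3 e1 e2 e3)))\<^sup>2"
  have "det (gram h (cols3 e1 e2 e3)) = -1"
    using e e(4-6)[THEN orthogonal_sym] by (simp add: det_3 gram_def column_cols3)
  then have d: "of_real ?d * det (gram h (mat 1)) = -1" using det_gram[of "cols3 e1 e2 e3"] by simp
  then have "?d \<noteq> 0" by (metis mult_zero_left of_real_0 zero_neq_neg_one)
  moreover have "?d \<ge> 0" by simp
  ultimately have p: "?d > 0" by linarith
  have "det (gram h (mat 1)) = - of_real (1 / ?d)"
    using d p by (simp add: field_simps)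
  then show ?thesis using that[of "1 / ?d"] p by auto
qed

lemma gram_det_nonzero: "det P \<noteq> 0 \<Longrightarrow> det (gram h P) \<noteq> 0"
  by (rule det_gram_neg) (simp add: det_gram[of P])

text \<open>
  Otherwise \<open>v\<close> and \<open>w\<close> span a totally isotropic plane, and completing them to a basis would give
  a vanishing Gram determinant.
\<close>

lemma null_not_orthogonal:
  assumes "v \<noteq> 0" "h v v = 0" "h w w = 0" "\<And>c. w \<noteq> c *s v"
  shows "h v w \<noteq> 0"
proof
  assume z: "h v w = 0"
  then have z': "h w v = 0" using orthogonal_sym by blast
  obtain x where "det (cols3 v w x) \<noteq> 0" using extend_to_basis[OF assms(1,4)] by blast
  then have "det (gram h (cols3 v w x)) \<noteq> 0" by (rule gram_det_nonzero)
  then show False using det_gram_null_pair[OF assms(2,3), of x] z z' by simp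
qed

text \<open>
  Subtracting suitable multiples of \<open>v\<close> and \<open>w\<close> from a third basis vector makes it orthogonal to
  them. The Gram determinant of the basis obtained is \<open>- \<bar>h v w\<bar>\<^sup>2 h m m\<close> and negative, so \<open>m\<close> is a
  positive vector and can be normalised.
\<close>

lemma unit_normal:
  assumes v: "h v v = 0" and w: "h w w = 0" and vw: "h v w \<noteq> 0"
  obtains n where "h v n = 0" "h w n = 0" "h n n = 1" "det (cols3 v w n) \<noteq> 0"
proof -
  have wv: "h w v \<noteq> 0" using vw orthogonal_sym by blast
  have "v \<noteq> 0" using vw zero_left by auto
  moreover have "w \<noteq> c *s v" for c using v vw by (auto simp: scale_right)
  ultimately obtain x where x: "det (cols3 v w x) \<noteq> 0" using extend_to_basis by blast
  define m where "m = x + (- (h x w / h v w)) *s v + (- (h x v / h w v)) *s w"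
  have "det (cols3 v w m) = det (cols3 v w x)"
    unfolding m_def by (rule det_cols3_add)
  then have dm: "det (cols3 v w m) \<noteq> 0" using x by simp
  have "h m v = 0" "h m w = 0" unfolding m_def form_simps using v w vw wv by simp_all
  then have o: "h v m = 0" "h w m = 0" "h m v = 0" "h m w = 0" using orthogonal_sym by blast+
  obtain r where r: "r > 0" "det (gram h (mat 1)) = - of_real r" by (rule det_gram_neg)
  have "det (gram h (cols3 v w m)) = - (of_real ((cmod (h v w))\<^sup>2) * h m m)"
    using det_gram_null_pair[OF v w, of m] o swap[of w v]
    unfolding complex_norm_square by (simp add: mult_ac)
  with det_gram[of "cols3 v w m"] r(2)
  have eq: "of_real ((cmod (h v w))\<^sup>2) * h m m = of_real ((cmod (det (cols3 v w m)))\<^sup>2 * r)"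
    by simp
  define d where "d = (cmod (det (cols3 v w m)))\<^sup>2 * r / (cmod (h v w))\<^sup>2"
  have "complex_of_real ((cmod (h v w))\<^sup>2) \<noteq> 0" using vw by simp
  then have hd: "h m m = of_real d"
    unfolding d_def of_real_divide eq[symmetric] by simp
  have d0: "d > 0" using dm r vw by (simp add: d_def)
  define n where "n = of_real (1 / sqrt d) *s m"
  have "of_real (1 / sqrt d) * (of_real (1 / sqrt d) * complex_of_real d) = of_real (1 / sqrt d * (1 / sqrt d * d))"
    by (simp only: of_real_mult)
  also have "1 / sqrt d * (1 / sqrt d * d) = 1" using d0 by (simp add: field_simps)
  finally have "h n n = 1" by (simp add: n_def form_simps hd)
  moreover have "h v n = 0" "h w n = 0" by (simp_all add: n_def form_simps o)
  moreover have "det (cols3 v w n) \<noteq> 0" using dm d0 by (simp add: n_def det_cols3_scale)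
  ultimately show thesis using that by blast
qed

lemma cmod_det_isometry:
  assumes "\<And>v w. h (T *v v) (T *v w) = h v w"
  shows "cmod (det T) = 1"
proof -
  have c: "column i T = T *v column i (mat 1)" for i
    by (simp add: vec_eq_iff column_def matrix_vector_mult_def mat_def if_distrib cong: if_cong)
  have "gram h T = gram h (mat 1)" unfolding gram_def using assms c by simp
  moreover obtain r where r: "r > 0" "det (gram h (mat 1)) = - of_real r" by (rule det_gram_neg)
  ultimately have "of_real ((cmod (det T))\<^sup>2) * complex_of_real r = of_real r"
    using det_gram[of T] by simp
  then have "complex_of_real ((cmod (det T))\<^sup>2) = of_real 1" using r by simp
  then have "(cmod (det T))\<^sup>2 = 1" by (simp only: of_real_eq_iff)
  then show ?thesis using norm_ge_zero[of "det T"] by (simp add: power2_eq_1_iff)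
qed

text \<open>
  Complete both pairs by unit normals \<open>a\<close> and \<open>b\<close>. The Gram matrices of the two bases agree, so
  the linear map between them is an isometry. Its determinant has modulus \<open>1\<close> by
  \<open>cmod_det_isometry\<close>, and it is made equal to \<open>1\<close> by sending \<open>a\<close> to a unitary multiple of \<open>b\<close>.
\<close>

lemma isometry_of_null_pairs_exists:
  assumes n: "h v v = 0" "h w w = 0" "h v' v' = 0" "h w' w' = 0"
    and eq: "h v' w' = h v w" and nz: "h v w \<noteq> 0"
  obtains T where "\<And>x y. h (T *v x) (T *v y) = h x y" "det T = 1" "T *v v = v'" "T *v w = w'"
proof -
  obtain a where a: "h v a = 0" "h w a = 0" "h a a = 1" "det (cols3 v w a) \<noteq> 0"
    using unit_normal[OF n(1,2) nz] by blast
  obtain b where b: "h v' b = 0" "h w' b = 0" "h b b = 1" "det (cols3 v' w' b) \<noteq> 0"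
    using unit_normal[OF n(3,4)] nz eq by metis
  let ?P = "cols3 v w a"
  obtain R where R: "R ** ?P = mat 1" "?P ** R = mat 1"
    using a(4) by (metis invertible_det_nz invertible_def)
  \<comment> \<open>The map sending \<open>v, w, a\<close> to \<open>v', w', c b\<close>; the factor \<open>c\<close> adjusts the determinant.\<close>
  define S where "S c = cols3 v' w' (c *s b) ** R" for c
  have SP: "S c ** ?P = cols3 v' w' (c *s b)" for c
    by (simp add: S_def matrix_mul_assoc[symmetric] R)
  have iso: "h (S c *v x) (S c *v y) = h x y" if "cmod c = 1" for c x y
  proof -
    have cc: "c * cnj c = 1" using that by (simp add: complex_norm_square[symmetric])
    have z: "h a v = 0" "h a w = 0" "h b v' = 0" "h b w' = 0" using a b orthogonal_sym by blast+
    have e: "h w' v' = h w v" using eq swap by metis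
    have g: "gram h (cols3 v' w' (c *s b)) = gram h ?P"
      unfolding vec_eq_iff forall_3
      using a b n z eq e cc by (simp add: gram_def column_cols3 form_simps)
    have "h (S c *v x) (S c *v y) = h (cols3 v' w' (c *s b) *v (R *v x)) (cols3 v' w' (c *s b) *v (R *v y))"
      by (simp add: S_def matrix_vector_mul_assoc)
    also have "\<dots> = h (?P *v (R *v x)) (?P *v (R *v y))"
      unfolding form_mult_vec g ..
    finally show ?thesis by (simp add: matrix_vector_mul_assoc R)
  qed
  have dS: "det (S c) = c * det (S 1)" for c
    unfolding S_def by (simp add: det_mul det_cols3_scale)
  define c where "c = inverse (det (S 1))"
  have m1: "cmod (det (S 1)) = 1" by (rule cmod_det_isometry) (rule iso, simp)
  then have mc: "cmod c = 1" by (simp add: c_def norm_inverse)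
  have "det (S 1) \<noteq> 0" using m1 by auto
  then have "det (S c) = 1" unfolding dS[of c] by (simp add: c_def)
  moreover have "cols3 (S c *v v) (S c *v w) (S c *v a) = cols3 v' w' (c *s b)"
    using SP[of c] by (simp add: matrix_mul_cols3)
  then have "S c *v v = v'" "S c *v w = w'" by (metis column_cols3)+
  ultimately show thesis using that[of "S c"] iso[OF mc] by blast
qed

text \<open>
  Such an isometry preserves the orthogonal complement of the pair, which is a line; the
  determinant forces it to act trivially on that line.
\<close>

lemma isometry_fixing_null_pair:
  assumes n: "h v v = 0" "h w w = 0" and nz: "h v w \<noteq> 0"
    and T: "\<And>x y. h (T *v x) (T *v y) = h x y" "det T = 1" "T *v v = v" "T *v w = w"
  shows "T = mat 1"
proof -
  obtain a where a: "h v a = 0" "h w a = 0" "h a a = 1" "det (cols3 v w a) \<noteq> 0"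
    using unit_normal[OF n nz] by blast
  let ?P = "cols3 v w a"
  obtain R where R: "R ** ?P = mat 1" "?P ** R = mat 1"
    using a(4) by (metis invertible_det_nz invertible_def)
  have wv: "h w v \<noteq> 0" using nz orthogonal_sym by blast
  have o: "h (T *v a) v = 0" "h (T *v a) w = 0"
    using T(1)[of a v] T(1)[of a w] T(3,4) a(1,2)[THEN orthogonal_sym] by auto
  define x where "x = R *v (T *v a)"
  have "T *v a = ?P *v x" by (simp add: x_def matrix_vector_mul_assoc R matrix_mul_assoc)
  then have Ta: "T *v a = x$1 *s v + x$2 *s w + x$3 *s a" by (simp only: cols3_vector)
  have "x$1 = 0" "x$2 = 0"
    using o n nz wv a(1,2)[THEN orthogonal_sym] unfolding Ta by (auto simp: form_simps)
  then have Ta': "T *v a = x$3 *s a" using Ta by simp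
  have TP: "T ** ?P = cols3 v w (x$3 *s a)" by (simp add: matrix_mul_cols3 T Ta')
  then have "det T * det ?P = x$3 * det ?P" by (metis det_mul det_cols3_scale)
  then have "x$3 = 1" using a(4) T(2) by simp
  then have "T ** ?P = ?P" using TP by simp
  then have "T ** (?P ** R) = ?P ** R" by (metis matrix_mul_assoc)
  then show ?thesis by (simp add: R)
qed

end

section \<open>Isometries and their lifts\<close>

definition projective_class :: "complex^3^3 \<Rightarrow> (complex^3^3) set" where
  "projective_class T = (\<lambda>c. mat c ** T) ` {c. cmod c = 1}"

lemma mat_mult_vec: "mat c *v v = c *s (v :: complex^3)"
  by (simp add: vec_eq_iff forall_3 matrix_vector_mult_def mat_def sum_3)

lemma scaled_mult_vec: "(mat c ** T) *v v = c *s ((T :: complex^3^3) *v v)"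
  by (simp add: matrix_vector_mul_assoc[symmetric] mat_mult_vec)

lemma mat_commutes: "mat c ** (T :: complex^3^3) = T ** mat c"
  unfolding matrix_eq by (simp add: scaled_mult_vec matrix_vector_mul_assoc[symmetric] mat_mult_vec
      vector_scalar_commute)

lemma mat_mult_mat: "mat a ** mat b = (mat (a * b) :: complex^3^3)"
  unfolding matrix_eq by (simp add: scaled_mult_vec mat_mult_vec vector_smult_assoc)

lemma self_in_projective_class: "T \<in> projective_class T"
  unfolding projective_class_def by (rule image_eqI[of _ _ 1]) simp_all

lemma projective_class_eqI:
  assumes "S \<in> projective_class T"
  shows "projective_class S = projective_class T"
proof -
  obtain c where c: "cmod c = 1" "S = mat c ** T" using assms by (auto simp: projective_class_def)
  have S: "mat d ** S = mat (d * c) ** T" for d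
    by (simp add: c(2) matrix_mul_assoc mat_mult_mat)
  have "c \<noteq> 0" using c(1) by auto
  then have "mat d ** T = mat (d * inverse c) ** S" for d
    by (simp add: S mult.assoc)
  then have "mat d ** T \<in> projective_class S" if "cmod d = 1" for d
    unfolding projective_class_def using that c(1)
    by (intro image_eqI[of _ _ "d * inverse c"]) (simp_all add: norm_mult norm_inverse)
  moreover have "mat d ** S \<in> projective_class T" if "cmod d = 1" for d
    unfolding projective_class_def S using that c(1)
    by (intro image_eqI[of _ _ "d * c"]) (simp_all add: norm_mult)
  ultimately show ?thesis unfolding projective_class_def[of S] projective_class_def[of T] by blast
qed

lemma act_projective_class:
  "act (projective_class T) (vec.span {v}) = vec.span {T *v v}"
proof (intro Set.set_eqI iffI)
  fix x assume "x \<in> act (projective_class T) (vec.span {v})"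
  then obtain c k where "x = (mat c ** T) *v (k *s v)"
    by (auto simp: act_def projective_class_def vec.span_singleton)
  then have "x = (c * k) *s (T *v v)"
    by (simp add: scaled_mult_vec vector_scalar_commute vector_smult_assoc)
  then show "x \<in> vec.span {T *v v}" by (auto simp: vec.span_singleton)
next
  fix x assume "x \<in> vec.span {T *v v}"
  then obtain k where "x = T *v (k *s v)" by (auto simp: vec.span_singleton vector_scalar_commute)
  then show "x \<in> act (projective_class T) (vec.span {v})"
    using self_in_projective_class[of T] by (auto simp: act_def vec.span_singleton)
qed

lemma span_singleton_eqD:
  assumes "vec.span {v} = vec.span {w :: complex^3}"
  obtains c where "v = c *s w"
proof -
  have "v \<in> vec.span {w}" using assms vec.span_base[of v "{v}"] by simp
  then show thesis using that by (auto simp: vec.span_singleton)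
qed

context hyperbolic_form
begin

lemma in_U21: "T \<in> carrier (U21 h) \<longleftrightarrow> (\<forall>v w. h (T *v v) (T *v w) = h v w)"
  by (simp add: U21_def)

lemma isometry_form: "T \<in> carrier (U21 h) \<Longrightarrow> h (T *v v) (T *v w) = h v w"
  by (simp add: in_U21)

lemma isometry_inverse:
  assumes "T \<in> carrier (U21 h)"
  obtains R where "R \<in> carrier (U21 h)" "R ** T = mat 1" "T ** R = mat 1"
proof -
  have "cmod (det T) = 1" using assms by (intro cmod_det_isometry) (simp add: in_U21)
  then have "det T \<noteq> 0" by auto
  then obtain R where R: "R ** T = mat 1" "T ** R = mat 1"
    by (metis invertible_det_nz invertible_def)
  have "h (R *v v) (R *v w) = h v w" for v w
    using isometry_form[OF assms, of "R *v v" "R *v w"] by (simp add: matrix_vector_mul_assoc R)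
  then show thesis using that[of R] R by (simp add: in_U21)
qed

lemma isometry_nonzero:
  assumes "T \<in> carrier (U21 h)" "v \<noteq> 0"
  shows "T *v v \<noteq> 0"
proof
  assume z: "T *v v = 0"
  obtain R where "R ** T = mat 1" using isometry_inverse[OF assms(1)] by blast
  then have "v = R *v (T *v v)" by (simp add: matrix_vector_mul_assoc)
  then show False using z assms(2) by simp
qed

lemma group_U21: "group (U21 h)"
proof (rule groupI)
  fix T assume "T \<in> carrier (U21 h)"
  then obtain R where "R \<in> carrier (U21 h)" "R ** T = mat 1" by (rule isometry_inverse)
  then show "\<exists>R\<in>carrier (U21 h). R \<otimes>\<^bsub>U21 h\<^esub> T = \<one>\<^bsub>U21 h\<^esub>" by (auto simp: U21_def)
qed (simp_all add: U21_def matrix_vector_mul_assoc[symmetric] matrix_mul_assoc)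

lemma scalar_in_U21: "cmod c = 1 \<Longrightarrow> mat c \<in> carrier (U21 h)"
  by (simp add: in_U21 mat_mult_vec form_simps mult.assoc[symmetric]
      complex_norm_square[symmetric] mult.commute[of "cnj c" c])

lemma unit_scalars_normal: "unit_scalars \<lhd> U21 h"
proof -
  interpret group "U21 h" by (rule group_U21)
  have mult: "S \<otimes>\<^bsub>U21 h\<^esub> T = S ** T" and one: "\<one>\<^bsub>U21 h\<^esub> = mat 1" for S T
    by (simp_all add: U21_def)
  have "inv\<^bsub>U21 h\<^esub> (mat c) = mat (inverse c)" if "cmod c = 1" for c
  proof (rule inv_equality)
    have "c \<noteq> 0" using that by auto
    then show "mat (inverse c) \<otimes>\<^bsub>U21 h\<^esub> mat c = \<one>\<^bsub>U21 h\<^esub>"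
      by (simp add: mult one mat_mult_mat)
  qed (use that in \<open>simp_all add: scalar_in_U21 norm_inverse\<close>)
  then have "subgroup unit_scalars (U21 h)"
    by (intro subgroupI)
      (auto simp: unit_scalars_def mult mat_mult_mat norm_inverse norm_mult intro: scalar_in_U21 exI[of _ 1])
  moreover have "x \<otimes>\<^bsub>U21 h\<^esub> k \<otimes>\<^bsub>U21 h\<^esub> inv\<^bsub>U21 h\<^esub> x \<in> unit_scalars"
    if x: "x \<in> carrier (U21 h)" and k: "k \<in> unit_scalars" for x k
  proof -
    obtain c where c: "k = mat c" "cmod c = 1" using k by (auto simp: unit_scalars_def)
    have "x \<otimes>\<^bsub>U21 h\<^esub> k = k \<otimes>\<^bsub>U21 h\<^esub> x" by (simp add: mult c mat_commutes)
    then have "x \<otimes>\<^bsub>U21 h\<^esub> k \<otimes>\<^bsub>U21 h\<^esub> inv\<^bsub>U21 h\<^esub> x = k"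
      using x c scalar_in_U21 by (simp add: m_assoc)
    then show ?thesis using k by simp
  qed
  ultimately show ?thesis unfolding normal_inv_iff by blast
qed

lemma coset_eq_projective_class: "unit_scalars #>\<^bsub>U21 h\<^esub> T = projective_class T"
  by (auto simp: r_coset_def unit_scalars_def projective_class_def U21_def)

lemma group_PU21: "group (PU21 h)"
  unfolding PU21_def by (rule normal.factorgroup_is_group[OF unit_scalars_normal])

lemma in_PU21: "A \<in> carrier (PU21 h) \<longleftrightarrow> (\<exists>T\<in>carrier (U21 h). A = projective_class T)"
  by (auto simp: PU21_def FactGroup_def RCOSETS_def coset_eq_projective_class)

lemma lift_in_U21:
  assumes "A \<in> carrier (PU21 h)" "T \<in> A"
  shows "T \<in> carrier (U21 h)" "A = projective_class T"
proof -
  interpret group "U21 h" by (rule group_U21)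
  obtain S where S: "S \<in> carrier (U21 h)" "A = projective_class S" using assms(1) by (auto simp: in_PU21)
  then obtain c where "cmod c = 1" "T = mat c ** S" using assms(2) by (auto simp: projective_class_def)
  then show "T \<in> carrier (U21 h)"
    using m_closed[OF scalar_in_U21 S(1)] by (simp add: U21_def)
  show "A = projective_class T" using projective_class_eqI assms(2) S(2) by metis
qed

lemma projective_class_mult:
  assumes "S \<in> carrier (U21 h)" "T \<in> carrier (U21 h)"
  shows "projective_class S \<otimes>\<^bsub>PU21 h\<^esub> projective_class T = projective_class (S ** T)"
  using normal.rcos_sum[OF unit_scalars_normal assms]
  by (simp add: PU21_def FactGroup_def coset_eq_projective_class[symmetric]) (simp add: U21_def)

lemma null_point_lift:
  assumes "p \<in> bdH2C h"
  obtains v where "v \<noteq> 0" "p = vec.span {v}" "h v v = 0"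
  using assms by (auto simp: bdH2C_def is_lift_def)

lemma null_point: "v \<noteq> 0 \<Longrightarrow> h v v = 0 \<Longrightarrow> vec.span {v} \<in> bdH2C h"
  by (auto simp: bdH2C_def is_lift_def)

lemma distinct_null_lines:
  assumes "v \<noteq> 0" "h v v = 0" "w \<noteq> 0" "h w w = 0" "vec.span {v} \<noteq> vec.span {w}"
  shows "h v w \<noteq> 0"
proof (rule null_not_orthogonal[OF assms(1,2,4)])
  show "w \<noteq> c *s v" for c
    using assms(3,5) span_scale[of c v] by (cases "c = 0") auto
qed

lemma act_mult:
  assumes "A \<in> carrier (PU21 h)" "B \<in> carrier (PU21 h)" "p \<in> bdH2C h"
  shows "act (A \<otimes>\<^bsub>PU21 h\<^esub> B) p = act A (act B p)"
proof -
  obtain v where v: "p = vec.span {v}" using assms(3) by (rule null_point_lift)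
  show ?thesis using assms(1,2)
    by (auto simp: in_PU21 projective_class_mult act_projective_class v matrix_vector_mul_assoc)
qed

lemma act_boundary:
  assumes "A \<in> carrier (PU21 h)" "p \<in> bdH2C h"
  shows "act A p \<in> bdH2C h"
proof -
  obtain v where v: "v \<noteq> 0" "p = vec.span {v}" "h v v = 0" using assms(2) by (rule null_point_lift)
  show ?thesis using assms(1) v
    by (auto simp: in_PU21 act_projective_class isometry_form isometry_nonzero intro!: null_point)
qed

lemma isometry_of_null_pair_unique:
  assumes n: "h v v = 0" "h w w = 0" and nz: "h v w \<noteq> 0"
    and S: "S \<in> carrier (U21 h)" "det S = 1" and T: "T \<in> carrier (U21 h)" "det T = 1"
    and eq: "S *v v = T *v v" "S *v w = T *v w"
  shows "S = T"
proof -
  obtain R where R: "R \<in> carrier (U21 h)" "R ** S = mat 1" "S ** R = mat 1"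
    using isometry_inverse[OF S(1)] by blast
  have "det R * det S = 1" by (metis R(2) det_I det_mul)
  then have "det (R ** T) = 1" using S(2) T(2) by (simp add: det_mul)
  moreover have "h ((R ** T) *v x) ((R ** T) *v y) = h x y" for x y
    using R(1) T(1) by (simp add: matrix_vector_mul_assoc[symmetric] isometry_form)
  moreover have "(R ** T) *v v = v" "(R ** T) *v w = w"
    by (simp_all add: matrix_vector_mul_assoc[symmetric] eq[symmetric])
      (simp_all add: matrix_vector_mul_assoc R(2))
  ultimately have "R ** T = mat 1" using isometry_fixing_null_pair[OF n nz] by blast
  then have "S ** (R ** T) = S" by simp
  then show ?thesis by (simp add: matrix_mul_assoc R(3))
qed

lemma eigenvector_lift:
  assumes "A \<in> carrier (PU21 h)" "fixes_with_eigenvalue A (vec.span {v}) l" "v \<noteq> 0"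
  obtains T where "T \<in> carrier (U21 h)" "A = projective_class T" "det T = 1" "T *v v = l *s v"
proof -
  obtain T u where T: "T \<in> A" "det T = 1" "is_lift u (vec.span {v})" "T *v u = l *s u"
    using assms(2) by (auto simp: fixes_with_eigenvalue_def)
  have "is_lift v (vec.span {v})" using assms(3) by (simp add: is_lift_def)
  then obtain c where "v = c *s u" using is_lift_scale[OF T(3)] by metis
  then have "T *v v = l *s v"
    by (simp add: vector_scalar_commute T(4) vector_smult_assoc mult.commute)
  then show thesis using that[of T] T(1,2) lift_in_U21[OF assms(1)] by blast
qed

section \<open>Isometries with a unitary eigenvalue at a boundary point\<close>

text \<open>
  Choose lifts \<open>v\<close>, \<open>w\<close>, \<open>w'\<close> of the three points. A lift of determinant \<open>1\<close> of the isometry maps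
  \<open>v\<close> to \<open>l v\<close> and \<open>w\<close> to a multiple of \<open>w'\<close>, and the multiple is determined because the form on
  the pair is preserved. So the images of a pair of null vectors are known.
\<close>

lemma isometry_with_eigenvalue:
  assumes p: "p \<in> bdH2C h" and q: "q \<in> bdH2C h" and q': "q' \<in> bdH2C h"
    and ne: "p \<noteq> q" "p \<noteq> q'" and l: "cmod l = 1"
  shows "\<exists>!A. A \<in> carrier (PU21 h) \<and> fixes_with_eigenvalue A p l \<and> act A q = q'"
proof -
  obtain v where v: "v \<noteq> 0" "p = vec.span {v}" "h v v = 0" using p by (rule null_point_lift)
  obtain w where w: "w \<noteq> 0" "q = vec.span {w}" "h w w = 0" using q by (rule null_point_lift)
  obtain w' where w': "w' \<noteq> 0" "q' = vec.span {w'}" "h w' w' = 0" using q' by (rule null_point_lift)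
  have vw: "h v w \<noteq> 0" and vw': "h v w' \<noteq> 0"
    using distinct_null_lines v w w' ne by simp_all
  have l0: "l \<noteq> 0" using l by auto
  \<comment> \<open>Preservation of the form on the pair leaves only this multiple of \<open>w'\<close> as image of \<open>w\<close>.\<close>
  define b where "b = cnj (h v w / (l * h v w'))"
  have b0: "b \<noteq> 0" using vw vw' l0 by (simp add: b_def)
  have b: "c = b" if "l * cnj c * h v w' = h v w" for c
  proof -
    have "cnj c = h v w / (l * h v w')" using that vw' l0 by (simp add: field_simps)
    then show ?thesis unfolding b_def by (metis complex_cnj_cnj)
  qed
  have hb: "h (l *s v) (b *s w') = h v w"
    unfolding form_simps b_def complex_cnj_cnj using vw' l0 by (simp add: field_simps)
  have "h (l *s v) (l *s v) = 0" "h (b *s w') (b *s w') = 0" by (simp_all add: form_simps v w')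
  then obtain T where T: "\<And>x y. h (T *v x) (T *v y) = h x y" "det T = 1"
      "T *v v = l *s v" "T *v w = b *s w'"
    using isometry_of_null_pairs_exists[OF v(3) w(3) _ _ hb vw] by blast
  have TU: "T \<in> carrier (U21 h)" using T(1) by (simp add: in_U21)
  show ?thesis
  proof (rule ex1I[of _ "projective_class T"], intro conjI)
    show "projective_class T \<in> carrier (PU21 h)" using TU by (auto simp: in_PU21)
    show "fixes_with_eigenvalue (projective_class T) p l"
      unfolding fixes_with_eigenvalue_def is_lift_def
      using self_in_projective_class T(2,3) v(1,2) by blast
    show "act (projective_class T) q = q'"
      by (simp add: w w' act_projective_class T(4) span_scale b0)
  next
    fix A assume A: "A \<in> carrier (PU21 h) \<and> fixes_with_eigenvalue A p l \<and> act A q = q'"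
    then obtain S where S: "S \<in> carrier (U21 h)" "A = projective_class S" "det S = 1" "S *v v = l *s v"
      using eigenvector_lift[of A v l] v by metis
    have "vec.span {S *v w} = vec.span {w'}" using A S(2) w(2) w'(2) act_projective_class by metis
    then obtain c where c: "S *v w = c *s w'" by (rule span_singleton_eqD)
    have "l * cnj c * h v w' = h v w"
      using isometry_form[OF S(1), of v w] unfolding S(4) c form_simps by (simp add: mult_ac)
    then have "c = b" by (rule b)
    then have "S = T"
      using isometry_of_null_pair_unique[OF v(3) w(3) vw S(1,3) TU T(2)] S(4) T(3,4) c by simp
    then show "A = projective_class T" using S(2) by simp
  qed
qed

text \<open>
  Suppose that a second boundary point, with lift \<open>w\<close>, is fixed. Since \<open>h v w\<close> is preserved and not
  zero, the eigenvalue at \<open>w\<close> is \<open>l\<close> too. Then the whole plane spanned by \<open>v\<close> and \<open>w\<close> is an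
  eigenspace, and it contains negative vectors, so the isometry is elliptic. Hence an isometry that
  is not elliptic has no second fixed point.
\<close>

lemma unitary_eigenvalue_imp_parabolic_or_elliptic:
  assumes T: "T \<in> carrier (U21 h)" and v: "v \<noteq> 0" "h v v = 0"
    and Tv: "T *v v = l *s v" and l: "cmod l = 1"
  shows "parabolic h (projective_class T) \<or> boundary_elliptic h (projective_class T)"
proof (cases "elliptic h (projective_class T)")
  case True
  have "act (projective_class T) (vec.span {v}) = vec.span {v}"
    using l by (subst act_projective_class) (auto simp: Tv intro!: span_scale)
  then show ?thesis using True v null_point by (auto simp: boundary_elliptic_def)
next
  case False
  have ll: "l * cnj l = 1" using l by (simp add: complex_norm_square[symmetric])
  have fix_v: "act (projective_class T) (vec.span {v}) = vec.span {v}"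
    using l by (subst act_projective_class) (auto simp: Tv intro!: span_scale)
  have "x = vec.span {v}" if x: "x \<in> H2C h \<union> bdH2C h" "act (projective_class T) x = x" for x
  proof (rule ccontr)
    assume ne: "x \<noteq> vec.span {v}"
    have "x \<in> bdH2C h" using x False by (auto simp: elliptic_def)
    then obtain w where w: "w \<noteq> 0" "x = vec.span {w}" "h w w = 0" by (rule null_point_lift)
    have vw: "h v w \<noteq> 0" using distinct_null_lines v w ne by simp
    have "vec.span {T *v w} = vec.span {w}" using x(2) w(2) act_projective_class by metis
    then obtain m where m: "T *v w = m *s w" by (rule span_singleton_eqD)
    have "l * cnj m * h v w = h v w"
      using isometry_form[OF T, of v w] unfolding Tv m form_simps by (simp add: mult_ac)
    then have "l * cnj m = l * cnj l" using vw ll by simp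
    then have ml: "m = l" using l by auto
    \<comment> \<open>The coefficient is chosen such that both cross terms of \<open>h u u\<close> equal \<open>- \<bar>h v w\<bar>\<^sup>2\<close>.\<close>
    define u where "u = v + (- h v w) *s w"
    have "h u u = - (h v w * cnj (h v w)) - h v w * cnj (h v w)"
      unfolding u_def form_simps by (simp add: v w swap[of w v])
    then have "h u u = of_real (- 2 * (cmod (h v w))\<^sup>2)"
      by (simp add: complex_norm_square[symmetric])
    then have "Re (h u u) = - 2 * (cmod (h v w))\<^sup>2" by (metis Re_complex_of_real)
    then have neg: "Re (h u u) < 0" using vw by simp
    then have "u \<noteq> 0" using zero_left by auto
    then have "vec.span {u} \<in> H2C h" using neg by (auto simp: H2C_def is_lift_def)
    moreover have "T *v u = l *s u"
      unfolding u_def by (simp only: matrix_vector_right_distrib vector_scalar_commute Tv m ml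
          vector_add_ldistrib vector_smult_assoc mult.commute)
    then have "act (projective_class T) (vec.span {u}) = vec.span {u}"
      using l by (subst act_projective_class) (auto intro!: span_scale)
    ultimately show False using False by (auto simp: elliptic_def)
  qed
  then have "{x \<in> H2C h \<union> bdH2C h. act (projective_class T) x = x} = {vec.span {v}}"
    using fix_v null_point v by auto
  then show ?thesis unfolding parabolic_def using null_point v by blast
qed

section \<open>Balanced tetrahedra\<close>

text \<open>
  For lifts with product \<open>-1\<close>, the projection of \<open>z\<close> onto the geodesic is represented by the
  combination of \<open>v1\<close> and \<open>v2\<close> with coefficients \<open>\<surd>r\<close> and \<open>1 / \<surd>r\<close>, where
  \<open>r = \<bar>h z v2\<bar> / \<bar>h z v1\<bar>\<close>. Two such vectors span the same line only if the ratios \<open>r\<close> agree.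
  The conclusion is homogeneous in each vector, so it holds for arbitrary lifts.
\<close>

lemma balanced_cross_ratio:
  assumes bal: "balanced h (vec.span {v1}) (vec.span {v2}) (vec.span {v3}) (vec.span {v4})"
    and nz: "v1 \<noteq> 0" "v2 \<noteq> 0" "v3 \<noteq> 0" "v4 \<noteq> 0" and null: "h v1 v1 = 0" "h v2 v2 = 0"
    and o: "h v1 v2 \<noteq> 0" "h v3 v1 \<noteq> 0" "h v3 v2 \<noteq> 0" "h v4 v1 \<noteq> 0" "h v4 v2 \<noteq> 0"
  shows "cmod (h v3 v2) * cmod (h v4 v1) = cmod (h v4 v2) * cmod (h v3 v1)"
proof -
  \<comment> \<open>Rescaling \<open>v2\<close> gives the lifts with product \<open>-1\<close>.\<close>
  define k where "k = cnj (-1 / h v1 v2)"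
  define u where "u = k *s v2"
  have k0: "k \<noteq> 0" using o(1) by (simp add: k_def)
  have hu: "h v1 u = -1" unfolding u_def scale_right k_def using o(1) by simp
  have hu': "h u v1 = -1" using swap[of u v1] hu by simp
  have uu: "h u u = 0" by (simp add: u_def form_simps null)
  have lifts: "is_lift v1 (vec.span {v1})" "is_lift u (vec.span {v2})"
    "is_lift v3 (vec.span {v3})" "is_lift v4 (vec.span {v4})"
    using nz k0 span_scale[OF k0, of v2] by (simp_all add: is_lift_def u_def)
  have "vec.span {proj_vector h v1 u v3} = vec.span {proj_vector h v1 u v4}"
    using bal geodesic_proj_eq[OF herm lifts(1,2,3) hu] geodesic_proj_eq[OF herm lifts(1,2,4) hu]
    by (simp add: balanced_def)
  then obtain c where c: "proj_vector h v1 u v3 = c *s proj_vector h v1 u v4" by (rule span_singleton_eqD)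
  define r where "r z = cmod (h z u) / cmod (h z v1)" for z
  have s: "cmod (h z v1) / cmod (h z u) = 1 / r z" for z by (simp add: r_def)
  have coords: "h (proj_vector h v1 u z) u = - of_real (sqrt (r z))"
    "h (proj_vector h v1 u z) v1 = - of_real (sqrt (1 / r z))" for z
    unfolding proj_vector_def s form_simps by (simp_all add: r_def hu hu' uu null)
  have r0: "r v3 > 0" "r v4 > 0" using o k0 by (simp_all add: r_def u_def scale_right norm_mult)
  have "complex_of_real (sqrt (r v3)) = c * of_real (sqrt (r v4))"
    "complex_of_real (sqrt (1 / r v3)) = c * of_real (sqrt (1 / r v4))"
    using coords[of v3] coords[of v4] unfolding c scale_left by simp_all
  then have "complex_of_real (sqrt (r v3)) * of_real (sqrt (1 / r v4))
      = of_real (sqrt (1 / r v3)) * of_real (sqrt (r v4))"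
    by simp
  then have "sqrt (r v3) * sqrt (1 / r v4) = sqrt (1 / r v3) * sqrt (r v4)"
    by (simp only: of_real_mult[symmetric] of_real_eq_iff)
  then have "sqrt (r v3 / r v4) = sqrt (r v4 / r v3)"
    by (simp add: real_sqrt_mult[symmetric])
  then have "r v3 / r v4 = r v4 / r v3" by simp
  then have "(r v3)\<^sup>2 = (r v4)\<^sup>2" using r0 by (simp add: field_simps power2_eq_square)
  then have "r v3 = r v4" using r0 by (simp add: power2_eq_iff)
  then show ?thesis using o k0
    by (simp add: r_def u_def scale_right norm_mult field_simps)
qed

text \<open>
  The factors \<open>a\<close> and \<open>b\<close> depend on the scaling of \<open>v3\<close> and \<open>v4\<close>, but \<open>a b\<close> is the eigenvalue of the
  product at \<open>v3\<close>. Comparing \<open>h v4 v1\<close> with its image under \<open>S\<close>, and \<open>h v3 v2\<close> with its image under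
  \<open>T\<close>, expresses \<open>\<bar>a\<bar>\<close> and \<open>\<bar>b\<bar>\<close> by the form.
\<close>

lemma product_eigenvalue_unitary:
  assumes bal: "cmod (h v3 v2) * cmod (h v4 v1) = cmod (h v4 v2) * cmod (h v3 v1)"
    and o: "h v3 v1 \<noteq> 0" "h v4 v2 \<noteq> 0"
    and S: "S \<in> carrier (U21 h)" "S *v v1 = l *s v1" "cmod l = 1" "S *v v4 = a *s v3"
    and T: "T \<in> carrier (U21 h)" "T *v v2 = m *s v2" "cmod m = 1" "T *v v3 = b *s v4"
  shows "cmod (a * b) = 1"
proof -
  have "cmod (h v4 v1) = cmod a * cmod (h v3 v1)"
    using arg_cong[OF isometry_form[OF S(1), of v4 v1], of cmod] S(3)
    unfolding S(2,4) form_simps by (simp add: norm_mult)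
  moreover have "cmod (h v3 v2) = cmod b * cmod (h v4 v2)"
    using arg_cong[OF isometry_form[OF T(1), of v3 v2], of cmod] T(3)
    unfolding T(2,4) form_simps by (simp add: norm_mult)
  ultimately show ?thesis using bal o by (simp add: norm_mult mult.commute)
qed

text \<open>
  This turns the conditions on \<open>AB\<close> and \<open>BA\<close> into separate conditions on \<open>A\<close> and on \<open>B\<close>. From left
  to right, the parabolic case uses that \<open>A\<close> maps the fixed points of \<open>BA\<close> to those of \<open>AB\<close>; from
  right to left, the balance of the tetrahedron makes the eigenvalue of both products unitary.
\<close>

lemma vertex_conditions_iff_swap:
  assumes bal: "balanced h p1 p2 p3 p4" and dist: "distinct [p1, p2, p3, p4]"
    and l: "cmod l = 1" "cmod m = 1"
    and A: "A \<in> carrier (PU21 h)" "fixes_with_eigenvalue A p1 l"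
    and B: "B \<in> carrier (PU21 h)" "fixes_with_eigenvalue B p2 m"
  defines "AB \<equiv> A \<otimes>\<^bsub>PU21 h\<^esub> B" and "BA \<equiv> B \<otimes>\<^bsub>PU21 h\<^esub> A"
  shows "((parabolic h AB \<or> boundary_elliptic h AB) \<and> act AB p3 = p3 \<and>
      (parabolic h BA \<or> boundary_elliptic h BA) \<and> act BA p4 = p4 \<and>
      (boundary_elliptic h AB \<longrightarrow> act B p3 = p4)) \<longleftrightarrow> act A p4 = p3 \<and> act B p3 = p4"
    (is "?L \<longleftrightarrow> ?R")
proof
  have p: "p1 \<in> bdH2C h" "p2 \<in> bdH2C h" "p3 \<in> bdH2C h" "p4 \<in> bdH2C h"
    using bal by (simp_all add: balanced_def)
  have act_AB: "act AB x = act A (act B x)" and act_BA: "act BA x = act B (act A x)"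
    if "x \<in> bdH2C h" for x
    using that A(1) B(1) by (simp_all add: AB_def BA_def act_mult)
  {
    assume L: ?L
    show ?R
    proof (cases "boundary_elliptic h AB")
      case True
      then have "act B p3 = p4" using L by blast
      then show ?thesis using L act_AB[OF p(3)] by metis
    next
      case False
      then have "parabolic h AB" using L by blast
      then obtain q where q: "{x \<in> H2C h \<union> bdH2C h. act AB x = x} = {q}"
        unfolding parabolic_def by blast
      have "x = q" if "x \<in> bdH2C h" "act AB x = x" for x
        using that unfolding singleton_iff[symmetric] q[symmetric] by simp
      then have unique: "x = p3" if "x \<in> bdH2C h" "act AB x = x" for x
        using that p(3) L by metis
      have "act AB (act A p4) = act A (act BA p4)"
        using act_AB act_BA act_boundary A(1) p(4) by simp
      then have "act A p4 = p3" using unique act_boundary A(1) p(4) L by simp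
      then show ?thesis using L act_BA[OF p(4)] by metis
    qed
  next
    assume R: ?R
    obtain v1 where v1: "v1 \<noteq> 0" "p1 = vec.span {v1}" "h v1 v1 = 0" using p(1) by (rule null_point_lift)
    obtain v2 where v2: "v2 \<noteq> 0" "p2 = vec.span {v2}" "h v2 v2 = 0" using p(2) by (rule null_point_lift)
    obtain v3 where v3: "v3 \<noteq> 0" "p3 = vec.span {v3}" "h v3 v3 = 0" using p(3) by (rule null_point_lift)
    obtain v4 where v4: "v4 \<noteq> 0" "p4 = vec.span {v4}" "h v4 v4 = 0" using p(4) by (rule null_point_lift)
    have o: "h v1 v2 \<noteq> 0" "h v3 v1 \<noteq> 0" "h v3 v2 \<noteq> 0" "h v4 v1 \<noteq> 0" "h v4 v2 \<noteq> 0"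
      using dist[unfolded v1(2) v2(2) v3(2) v4(2)]
        distinct_null_lines[OF v1(1,3) v2(1,3)] distinct_null_lines[OF v3(1,3) v1(1,3)]
        distinct_null_lines[OF v3(1,3) v2(1,3)] distinct_null_lines[OF v4(1,3) v1(1,3)]
        distinct_null_lines[OF v4(1,3) v2(1,3)]
      unfolding distinct.simps list.set by blast+
    have cr: "cmod (h v3 v2) * cmod (h v4 v1) = cmod (h v4 v2) * cmod (h v3 v1)"
      by (rule balanced_cross_ratio[OF bal[unfolded v1(2) v2(2) v3(2) v4(2)]
            v1(1) v2(1) v3(1) v4(1) v1(3) v2(3) o])
    obtain S where S: "S \<in> carrier (U21 h)" "A = projective_class S" "S *v v1 = l *s v1"
      using eigenvector_lift[of A v1 l] A v1 by metis
    obtain T where T: "T \<in> carrier (U21 h)" "B = projective_class T" "T *v v2 = m *s v2"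
      using eigenvector_lift[of B v2 m] B v2 by metis
    have "vec.span {S *v v4} = vec.span {v3}" using R S(2) v3(2) v4(2) act_projective_class by metis
    then obtain a where a: "S *v v4 = a *s v3" by (rule span_singleton_eqD)
    have "vec.span {T *v v3} = vec.span {v4}" using R T(2) v3(2) v4(2) act_projective_class by metis
    then obtain b where b: "T *v v3 = b *s v4" by (rule span_singleton_eqD)
    have ab: "cmod (a * b) = 1"
      by (rule product_eigenvalue_unitary[OF cr o(2,5) S(1,3) l(1) a T(1,3) l(2) b])
    have AB: "AB = projective_class (S ** T)" and BA: "BA = projective_class (T ** S)"
      using S T by (simp_all add: AB_def BA_def projective_class_mult)
    have STU: "S ** T \<in> carrier (U21 h)" "T ** S \<in> carrier (U21 h)"
      using S(1) T(1) by (simp_all add: in_U21 matrix_vector_mul_assoc[symmetric])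
    have ev: "(S ** T) *v v3 = (a * b) *s v3" "(T ** S) *v v4 = (a * b) *s v4"
      by (simp_all add: matrix_vector_mul_assoc[symmetric] a b vector_scalar_commute
          vector_smult_assoc mult.commute)
    have "parabolic h AB \<or> boundary_elliptic h AB"
      unfolding AB
      by (rule unitary_eigenvalue_imp_parabolic_or_elliptic[OF STU(1) v3(1,3) ev(1) ab])
    moreover have "parabolic h BA \<or> boundary_elliptic h BA"
      unfolding BA
      by (rule unitary_eigenvalue_imp_parabolic_or_elliptic[OF STU(2) v4(1,3) ev(2) ab])
    ultimately show ?L using R act_AB[OF p(3)] act_BA[OF p(4)] by simp
  }
qed

end

section \<open>Existence and uniqueness of the representation\<close>

theorem proposition3p2:
  fixes h :: form
    and p\<^sub>1 p\<^sub>2 p\<^sub>3 p\<^sub>4 :: point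
    and l\<^sub>A l\<^sub>B :: complex
  assumes "signature_2_1 h"
    and "balanced h p\<^sub>1 p\<^sub>2 p\<^sub>3 p\<^sub>4"
    and "distinct [p\<^sub>1, p\<^sub>2, p\<^sub>3, p\<^sub>4]"
    and "cmod l\<^sub>A = 1"
    and "cmod l\<^sub>B = 1"
  shows "\<exists>!\<rho>. \<rho> \<in> hom F2 (PU21 h) \<and> \<rho> \<in> extensional (carrier F2) \<and>
    fixes_with_eigenvalue (\<rho> gen_a) p\<^sub>1 l\<^sub>A \<and>
    fixes_with_eigenvalue (\<rho> gen_b) p\<^sub>2 l\<^sub>B \<and>
    (let AB = \<rho> (gen_a \<otimes>\<^bsub>F2\<^esub> gen_b); BA = \<rho> (gen_b \<otimes>\<^bsub>F2\<^esub> gen_a) in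
      (parabolic h AB \<or> boundary_elliptic h AB) \<and> act AB p\<^sub>3 = p\<^sub>3 \<and>
      (parabolic h BA \<or> boundary_elliptic h BA) \<and> act BA p\<^sub>4 = p\<^sub>4 \<and>
      (boundary_elliptic h AB \<longrightarrow> act (\<rho> gen_b) p\<^sub>3 = p\<^sub>4))"
    (is "\<exists>!\<rho>. ?P \<rho>")
proof -
  interpret hyperbolic_form h
    using assms(1) by unfold_locales (auto simp: signature_2_1_def)
  let ?isom = "\<lambda>A p l q q'. A \<in> carrier (PU21 h) \<and> fixes_with_eigenvalue A p l \<and> act A q = q'"
  have p: "p\<^sub>1 \<in> bdH2C h" "p\<^sub>2 \<in> bdH2C h" "p\<^sub>3 \<in> bdH2C h" "p\<^sub>4 \<in> bdH2C h"
    using assms(2) by (simp_all add: balanced_def)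
  have "\<exists>!A. ?isom A p\<^sub>1 l\<^sub>A p\<^sub>4 p\<^sub>3"
    by (rule isometry_with_eigenvalue) (use p assms(3,4) in auto)
  then obtain A where A: "\<And>X. ?isom X p\<^sub>1 l\<^sub>A p\<^sub>4 p\<^sub>3 \<longleftrightarrow> X = A" by metis
  have "\<exists>!B. ?isom B p\<^sub>2 l\<^sub>B p\<^sub>3 p\<^sub>4"
    by (rule isometry_with_eigenvalue) (use p assms(3,5) in auto)
  then obtain B where B: "\<And>X. ?isom X p\<^sub>2 l\<^sub>B p\<^sub>3 p\<^sub>4 \<longleftrightarrow> X = B" by metis
  have gens: "gen_a \<in> carrier F2" "gen_b \<in> carrier F2"
    by (simp_all add: F2_def gen_a_def gen_b_def reduced_def)
  have P: "?P \<rho> \<longleftrightarrow> \<rho> \<in> hom F2 (PU21 h) \<and> \<rho> \<in> extensional (carrier F2) \<and>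
      \<rho> gen_a = A \<and> \<rho> gen_b = B" for \<rho>
  proof (cases "\<rho> \<in> hom F2 (PU21 h)")
    case True
    have "\<rho> gen_a \<in> carrier (PU21 h)" "\<rho> gen_b \<in> carrier (PU21 h)"
      using hom_in_carrier[OF True] gens by blast+
    then show ?thesis
      unfolding Let_def hom_mult[OF True gens] hom_mult[OF True gens(2,1)]
        A[symmetric] B[symmetric]
      using vertex_conditions_iff_swap[OF assms(2-5), of "\<rho> gen_a" "\<rho> gen_b"] by blast
  qed simp
  have "A \<in> carrier (PU21 h)" "B \<in> carrier (PU21 h)" using A B by blast+
  then show ?thesis unfolding P by (rule group.F2_universal[OF group_PU21])
qed

end
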